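(* For $n\geq2$ and $0\leq t\leq n-2$, the number of Fibonacci polyominoes $P\in\mathcal F_{n,n}$ with $\operatorname{lev}(P)=t$ equals \[ \binom{n-2}{t}M_{n-2-t}, \] where $M_k$ is the $k$th Motzkin number. The number is $0$ for $t>n-2$. In particular, the number of $P\in\mathcal F_{n,n}$ with $\operatorname{lev}(P)=0$ is $M_{n-2}$.
   Context: A Fibonacci polyomino is a (nonempty) polyomino, considered up to translation, that is column-convex (each column is a contiguous segment of unit cells) and such that, reading columns from left to right, the bottom cell of each column lies exactly one unit above the bottom cell of the preceding column. Equivalently, it is given by a sequence of column heights $(h_1,\dots,h_m)$, $m\ge 1$, with $h_i\ge 2$ for $1\le i\le m-1$ and $h_m\ge 1$; column $i$ consists of the cells in column position $i$ and rows $i,i+1,\dots,i+h_i-1$. The horizontal (resp. vertical) semiperimeter is half the number of horizontal (resp. vertical) unit edges on the boundary (edges belonging to exactly one cell). $\mathcal F_{n,n}$ is the set of Fibonacci polyominoes with horizontal semiperimeter $n$ (equivalently $n$ columns) and vertical semiperimeter $n$. For $P$ with column heights $(h_1,\ldots,h_n)$: $\operatorname{lev}(P)=|\{i:1\le i<n,\ h_i=h_{i+1}\}|$. Motzkin numbers: $M_k=\sum_{i\ge0}\binom{k}{2i}C_i$ with $C_i=\frac1{i+1}\binom{2i}{i}$, so $M_0,M_1,M_2,\ldots=1,1,2,4,9,21,\ldots$. *)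

theory Defs
  imports Complex_Main "HOL-Library.Product_Plus"
begin

text \<open>
  The cell \<open>(x, y)\<close> is the unit square \<open>[x, x + 1] \<times> [y, y + 1]\<close>, so \<open>x\<close> is its column and
  \<open>y\<close> its row.
\<close>

type_synonym cell = "int \<times> int"

definition adjacent :: "cell \<Rightarrow> cell \<Rightarrow> bool" where
  "adjacent c d \<longleftrightarrow> \<bar>fst c - fst d\<bar> + \<bar>snd c - snd d\<bar> = 1"

definition polyomino :: "cell set \<Rightarrow> bool" where
  "polyomino P \<longleftrightarrow> finite P \<and> P \<noteq> {} \<and>
     (\<forall>c\<in>P. \<forall>d\<in>P. (c, d) \<in> {(a, b). a \<in> P \<and> b \<in> P \<and> adjacent a b}\<^sup>*)"

definition column :: "cell set \<Rightarrow> int \<Rightarrow> int set" where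
  "column P x = {y. (x, y) \<in> P}"

definition column_convex :: "cell set \<Rightarrow> bool" where
  "column_convex P \<longleftrightarrow>
     (\<forall>x. \<forall>y\<^sub>1\<in>column P x. \<forall>y\<^sub>2\<in>column P x. {y\<^sub>1..y\<^sub>2} \<subseteq> column P x)"

definition fibonacci_polyomino :: "cell set \<Rightarrow> bool" where
  "fibonacci_polyomino P \<longleftrightarrow> polyomino P \<and> column_convex P \<and>
     (\<forall>x. column P x \<noteq> {} \<and> column P (x + 1) \<noteq> {} \<longrightarrow>
        Min (column P (x + 1)) = Min (column P x) + 1)"

text \<open>
  A horizontal edge is named by its left endpoint and a vertical edge by its lower endpoint.
\<close>

definition horizontal_edges :: "cell \<Rightarrow> (int \<times> int) set" where
  "horizontal_edges c = {c, c + (0, 1)}"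

definition vertical_edges :: "cell \<Rightarrow> (int \<times> int) set" where
  "vertical_edges c = {c, c + (1, 0)}"

definition horizontal_semiperimeter :: "cell set \<Rightarrow> real" where
  "horizontal_semiperimeter P = real (card {e. \<exists>!c. c \<in> P \<and> e \<in> horizontal_edges c}) / 2"

definition vertical_semiperimeter :: "cell set \<Rightarrow> real" where
  "vertical_semiperimeter P = real (card {e. \<exists>!c. c \<in> P \<and> e \<in> vertical_edges c}) / 2"

definition height :: "cell set \<Rightarrow> int \<Rightarrow> nat" where
  "height P x = card (column P x)"

definition lev :: "cell set \<Rightarrow> nat" where
  "lev P = card {x. column P x \<noteq> {} \<and> column P (x + 1) \<noteq> {} \<and> height P x = height P (x + 1)}"

definition translation_class :: "cell set \<Rightarrow> cell set set" where
  "translation_class P = range (\<lambda>v. (+) v ` P)"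

definition fibonacci_polyominoes :: "nat \<Rightarrow> nat \<Rightarrow> cell set set set" ("\<F>") where
  "\<F> h v = translation_class ` {P. fibonacci_polyomino P \<and>
     horizontal_semiperimeter P = real h \<and> vertical_semiperimeter P = real v}"

lemma column_translate: "column ((+) v ` P) x = (+) (snd v) ` column P (x - fst v)"
  by (cases v) (force simp: column_def image_iff)

lemma lev_translate: "lev ((+) v ` P) = lev P"
proof -
  let ?S = "\<lambda>P. {x. column P x \<noteq> {} \<and> column P (x + 1) \<noteq> {} \<and> height P x = height P (x + 1)}"
  have h: "height ((+) v ` P) x = height P (x - fst v)" for x
    by (simp add: height_def column_translate card_image)
  have iff: "x \<in> ?S ((+) v ` P) \<longleftrightarrow> x - fst v \<in> ?S P" for x
    by (simp add: column_translate h diff_add_eq)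
  have "?S ((+) v ` P) = (+) (fst v) ` ?S P"
  proof (rule set_eqI)
    fix x
    have im: "x - fst v \<in> A \<longleftrightarrow> x \<in> (+) (fst v) ` A" for A
      by (force simp: image_iff)
    show "x \<in> ?S ((+) v ` P) \<longleftrightarrow> x \<in> (+) (fst v) ` ?S P"
      by (rule trans[OF iff im])
  qed
  then show ?thesis
    by (simp only: lev_def) (simp add: card_image)
qed

text \<open>Hence \<open>lev\<close> is well defined on translation classes.\<close>

definition class_lev :: "cell set set \<Rightarrow> nat" where
  "class_lev C = (THE k. \<forall>P\<in>C. lev P = k)"

lemma class_lev_translation_class: "class_lev (translation_class P) = lev P"
  unfolding class_lev_def translation_class_def by (rule the_equality) (auto simp: lev_translate)

text \<open>The division is exact.\<close>

definition catalan :: "nat \<Rightarrow> nat" where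
  "catalan i = ((2 * i) choose i) div (i + 1)"

text \<open>The summands vanish for \<open>2 * i > k\<close>.\<close>

definition motzkin :: "nat \<Rightarrow> nat" where
  "motzkin k = (\<Sum>i\<le>k. (k choose (2 * i)) * catalan i)"

end

theory Submission
  imports Defs
begin

text \<open>
  Read the columns of a Fibonacci polyomino from right to left, with heights
  \<open>a\<^sub>0, a\<^sub>1, \<dots>\<close>. Telescoping the increments in the vertical perimeter shows that both
  semiperimeters agree exactly if \<open>a\<^sub>0 = 1\<close> and \<open>2 \<le> a\<^sub>i\<^sub>+\<^sub>1 \<le> a\<^sub>i + 1\<close>; in particular
  \<open>a\<^sub>1 = 2\<close>. Levels can be inserted freely into such a sequence, which gives the factor
  \<open>(n - 2) choose t\<close> and leaves the sequences without levels. If \<open>f k h\<close> counts those that make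
  \<open>k\<close> further steps from height \<open>h + 2\<close>, then \<open>f (k + 1) h = f k (h + 1) + (\<Sum>j<h. f k j)\<close>. In
  the basis of the functions \<open>h \<mapsto> h choose m\<close> this operator sends the \<open>m\<close>-th basis element to
  the sum of those with index \<open>m - 1\<close>, \<open>m\<close> and \<open>m + 1\<close>, so it is the step operator of Motzkin
  paths, and \<open>f k 0\<close> is the Motzkin number.
\<close>

section \<open>Ballot walks and Catalan numbers\<close>

text \<open>Counts walks of \<open>i\<close> steps +1 or -1 from 0 to \<open>m\<close> that never go
  below 0; the recursion removes the last step.\<close>

fun ballot :: "nat \<Rightarrow> nat \<Rightarrow> nat" where
  "ballot 0 m = (if m = 0 then 1 else 0)"
| "ballot (Suc i) 0 = ballot i 1"
| "ballot (Suc i) (Suc m) = ballot i m + ballot i (m + 2)"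

text \<open>The same walks without the barrier at 0: \<open>(i + m) div 2\<close> of the
  \<open>i\<close> steps go up, which requires the parities of \<open>i\<close> and \<open>m\<close>
  to agree.\<close>

definition free_walks :: "nat \<Rightarrow> nat \<Rightarrow> nat" where
  "free_walks i m = (if even (i + m) then i choose ((i + m) div 2) else 0)"

lemma free_walks_Suc: "free_walks (Suc i) (Suc m) = free_walks i m + free_walks i (m + 2)"
  by (auto simp: free_walks_def)

text \<open>The last step into 0 comes from 1 or from -1, and by symmetry both cases are equally
  frequent.\<close>

lemma free_walks_Suc_0: "free_walks (Suc i) 0 = 2 * free_walks i 1"
proof (cases "even i")
  case False
  then obtain l where i: "i = 2 * l + 1" by (auto elim: oddE)
  have "(2 * l + 1) choose l = (2 * l + 1) choose (l + 1)"
    using binomial_symmetric[of l "2 * l + 1"] by simp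
  then show ?thesis by (simp add: free_walks_def i)
qed (simp add: free_walks_def)

(* Reflection principle: the walks from 0 to m that visit -1 reflect to those ending at -m - 2,
   which by symmetry are as many as those ending at m + 2. *)
lemma ballot_reflection: "ballot i m + free_walks i (m + 2) = free_walks i m"
proof (induction i m rule: ballot.induct)
  case (1 m)
  then show ?case by (auto simp: free_walks_def binomial_eq_0)
next
  case (2 i)
  then show ?case
    using free_walks_Suc_0[of i] free_walks_Suc[of i 1] by (simp add: numeral_eq_Suc)
next
  case (3 i m)
  then show ?case
    using free_walks_Suc[of i m] free_walks_Suc[of i "m + 2"] by (simp add: numeral_eq_Suc)
qed

lemma ballot_odd: "odd i \<Longrightarrow> ballot i 0 = 0"
  using ballot_reflection[of i 0] by (simp add: free_walks_def)

text \<open>Reflection gives the difference of \<open>2 * i choose i\<close> and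
  \<open>2 * i choose Suc i\<close>. Multiplied by \<open>Suc i\<close> it collapses to
  \<open>2 * i choose i\<close>, so the division in \<open>catalan\<close> is exact.\<close>

lemma ballot_even: "ballot (2 * i) 0 = catalan i"
proof -
  have "ballot (2 * i) 0 + (2 * i choose Suc i) = 2 * i choose i"
    using ballot_reflection[of "2 * i" 0] by (simp add: free_walks_def)
  moreover have "Suc i * (2 * i choose Suc i) = i * (2 * i choose i)"
    using binomial_absorb_comp[of "2 * i" i] binomial_absorption[of i "2 * i"]
    by (cases i) (simp_all add: binomial_absorption)
  ultimately have "Suc i * ballot (2 * i) 0 + i * (2 * i choose i) = Suc i * (2 * i choose i)"
    by (metis add_mult_distrib2)
  then have "Suc i * ballot (2 * i) 0 = 2 * i choose i" by simp
  then show ?thesis unfolding catalan_def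
    by (metis Suc_eq_plus1 nonzero_mult_div_cancel_left nat.simps(3))
qed

section \<open>Motzkin paths\<close>

text \<open>Counts walks of \<open>k\<close> steps +1, 0 or -1 from 0 to \<open>m\<close> that never
  go below 0, again by the last step.\<close>

fun motzkin_paths :: "nat \<Rightarrow> nat \<Rightarrow> nat" where
  "motzkin_paths 0 m = (if m = 0 then 1 else 0)"
| "motzkin_paths (Suc k) 0 = motzkin_paths k 0 + motzkin_paths k 1"
| "motzkin_paths (Suc k) (Suc m) =
     motzkin_paths k m + motzkin_paths k (Suc m) + motzkin_paths k (m + 2)"

text \<open>Pascal's rule under the sum. It serves twice: to remove a step of a Motzkin path, and to
  expand \<open>level_free k (Suc h)\<close> in the binomials of \<open>h\<close>.\<close>

lemma sum_binomial_Suc: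
  fixes f :: "nat \<Rightarrow> nat"
  shows "(\<Sum>i\<le>Suc k. (Suc k choose i) * f i) = (\<Sum>i\<le>k. (k choose i) * (f i + f (Suc i)))"
proof -
  have "(\<Sum>i\<le>Suc k. (Suc k choose i) * f i) =
      f 0 + (\<Sum>i\<le>k. (k choose Suc i) * f (Suc i)) + (\<Sum>i\<le>k. (k choose i) * f (Suc i))"
    by (subst sum.atMost_Suc_shift) (simp add: sum.distrib add_mult_distrib)
  also have "f 0 + (\<Sum>i\<le>k. (k choose Suc i) * f (Suc i)) = (\<Sum>i\<le>Suc k. (k choose i) * f i)"
    by (subst sum.atMost_Suc_shift) simp
  also have "\<dots> = (\<Sum>i\<le>k. (k choose i) * f i)" by (simp add: binomial_eq_0)
  finally show ?thesis by (simp add: sum.distrib add_mult_distrib2)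
qed

text \<open>Choose the \<open>i\<close> steps that are not horizontal; they form a ballot
  walk.\<close>

lemma motzkin_paths_ballot: "motzkin_paths k m = (\<Sum>i\<le>k. (k choose i) * ballot i m)"
proof (induction k m rule: motzkin_paths.induct)
  case (2 k)
  then show ?case by (subst sum_binomial_Suc) (simp add: sum.distrib add_mult_distrib2)
next
  case (3 k m)
  then show ?case by (subst sum_binomial_Suc) (simp add: sum.distrib add_mult_distrib2)
qed simp

lemma motzkin_paths_0: "motzkin_paths k 0 = motzkin k"
proof -
  \<comment> \<open>The range is extended to \<open>2 * k\<close> so that its even members are
    exactly the doubles of \<open>{..k}\<close>, the index set of \<open>motzkin\<close>.\<close>
  have "motzkin_paths k 0 = (\<Sum>i\<in>{..2 * k}. (k choose i) * ballot i 0)"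
    unfolding motzkin_paths_ballot
    by (rule sum.mono_neutral_left) (auto simp: binomial_eq_0)
  also have "\<dots> = (\<Sum>i\<in>(*) 2 ` {..k}. (k choose i) * ballot i 0)"
  proof (rule sum.mono_neutral_right)
    have "odd i" if "i \<in> {..2 * k} - (*) 2 ` {..k}" for i
      using that by (auto elim!: evenE)
    then show "\<forall>i\<in>{..2 * k} - (*) 2 ` {..k}. (k choose i) * ballot i 0 = 0"
      by (simp add: ballot_odd)
  qed auto
  also have "\<dots> = motzkin k"
    by (subst sum.reindex) (auto simp: inj_on_def motzkin_def ballot_even)
  finally show ?thesis .
qed

section \<open>Sequences without levels in the binomial basis\<close>

text \<open>The function \<open>f\<close> of the introduction, defined by its coefficients in the
  binomial basis; its combinatorial meaning is the case \<open>t = 0\<close> of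
  \<open>card_walks\<close>.\<close>

definition level_free :: "nat \<Rightarrow> nat \<Rightarrow> nat" where
  "level_free k h = (\<Sum>m\<le>h. (h choose m) * motzkin_paths k m)"

lemma level_free_0: "level_free 0 h = 1"
  by (simp add: level_free_def if_distrib cong: if_cong)

text \<open>A bound independent of \<open>h\<close> allows sums over several starting heights to be
  interchanged.\<close>

lemma level_free_atMost:
  assumes "h \<le> H"
  shows "level_free k h = (\<Sum>m\<le>H. (h choose m) * motzkin_paths k m)"
  unfolding level_free_def
  by (rule sum.mono_neutral_left) (use assms in \<open>auto simp: binomial_eq_0\<close>)

text \<open>The hockey-stick identity: summation over smaller heights raises the basis index by
  one.\<close>

lemma sum_lessThan_choose: "(\<Sum>j<h. j choose m) = h choose Suc m"
  by (induction h) simp_all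

text \<open>Compare coefficients of \<open>h choose m\<close>. The shift to \<open>Suc h\<close>
  contributes those of index \<open>m\<close> and \<open>m + 1\<close>, the sum over smaller heights
  the one of index \<open>m - 1\<close>; together they are a Motzkin step.\<close>

lemma level_free_Suc: "level_free (Suc k) h = level_free k (Suc h) + (\<Sum>j<h. level_free k j)"
proof -
  define g where "g = motzkin_paths k"
  have "(\<Sum>j<h. level_free k j) = (\<Sum>j<h. \<Sum>m\<le>Suc h. (j choose m) * g m)"
    unfolding g_def by (intro sum.cong refl level_free_atMost) simp
  also have "\<dots> = (\<Sum>m\<le>Suc h. (h choose Suc m) * g m)"
    by (subst sum.swap) (simp only: sum_distrib_right[symmetric] sum_lessThan_choose)
  also have "\<dots> = (\<Sum>m<h. (h choose Suc m) * g m)"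
    by (rule sum.mono_neutral_right) (auto simp: binomial_eq_0)
  finally have 1: "(\<Sum>j<h. level_free k j) = (\<Sum>m<h. (h choose Suc m) * g m)" .
  have 2: "level_free k (Suc h) = (\<Sum>i\<le>h. (h choose i) * (g i + g (Suc i)))"
    unfolding level_free_def g_def by (rule sum_binomial_Suc)
  \<comment> \<open>The case distinction guards the boundary \<open>m = 0\<close>, where the
    truncated \<open>m - 1\<close> would count index 0 twice.\<close>
  have "level_free (Suc k) h = (\<Sum>m\<le>h. (h choose m) * (g m + g (Suc m) + (if m = 0 then 0 else g (m - 1))))"
    unfolding level_free_def g_def
  proof (rule sum.cong)
    fix m show "(h choose m) * motzkin_paths (Suc k) m = (h choose m) * (motzkin_paths k m
      + motzkin_paths k (Suc m) + (if m = 0 then 0 else motzkin_paths k (m - 1)))"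
      by (cases m) simp_all
  qed simp
  also have "\<dots> = level_free k (Suc h) + (\<Sum>m\<le>h. (h choose m) * (if m = 0 then 0 else g (m - 1)))"
    unfolding 2 by (simp add: sum.distrib add_mult_distrib2)
  also have "(\<Sum>m\<le>h. (h choose m) * (if m = 0 then 0 else g (m - 1))) = (\<Sum>m<h. (h choose Suc m) * g m)"
    by (subst sum.atMost_shift) simp
  finally show ?thesis by (simp add: 1)
qed

section \<open>Height sequences with a given number of levels\<close>

abbreviation step :: "nat \<Rightarrow> nat \<Rightarrow> bool" where
  "step x y \<equiv> 2 \<le> y \<and> y \<le> Suc x"

fun levels :: "nat list \<Rightarrow> nat" where
  "levels (x # y # ys) = (if x = y then 1 else 0) + levels (y # ys)"
| "levels _ = 0"

lemma levels_eq_card: "levels xs = card {i. Suc i < length xs \<and> xs ! i = xs ! Suc i}"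
proof (induction xs rule: levels.induct)
  case (1 x y ys)
  let ?S = "\<lambda>xs. {i. Suc i < length xs \<and> xs ! i = xs ! Suc i}"
  have "finite (?S zs)" for zs :: "nat list"
    by (rule finite_subset[of _ "{..<length zs}"]) auto
  moreover have "?S (x # y # ys) = (if x = y then {0} else {}) \<union> Suc ` ?S (y # ys)"
  proof (rule set_eqI)
    fix i show "i \<in> ?S (x # y # ys) \<longleftrightarrow> i \<in> (if x = y then {0} else {}) \<union> Suc ` ?S (y # ys)"
      by (cases i) auto
  qed
  ultimately show ?case using 1 by (simp add: card_image)
qed auto

text \<open>The starting height \<open>h\<close> is not in the list but takes part in the first step
  and the first possible level, so that recursion on the list restarts from its head.\<close>

definition walks :: "nat \<Rightarrow> nat \<Rightarrow> nat \<Rightarrow> nat list set" where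
  "walks k t h = {xs. length xs = k \<and> successively step (h # xs) \<and> levels (h # xs) = t}"

lemma walks_0: "walks 0 t h = (if t = 0 then {[]} else {})"
  by (auto simp: walks_def)

lemma walks_Suc:
  "walks (Suc k) t h = (\<Union>x\<in>{2..Suc h} - {h}. (#) x ` walks k t x) \<union>
     (if 2 \<le> h \<and> 0 < t then (#) h ` walks k (t - 1) h else {})"
proof (rule set_eqI)
  fix xs show "xs \<in> walks (Suc k) t h \<longleftrightarrow> xs \<in> (\<Union>x\<in>{2..Suc h} - {h}. (#) x ` walks k t x) \<union>
     (if 2 \<le> h \<and> 0 < t then (#) h ` walks k (t - 1) h else {})"
    by (cases xs) (auto simp: walks_def)
qed

lemma finite_walks: "finite (walks k t h)"
  by (induction k arbitrary: t h) (auto simp: walks_0 walks_Suc)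

lemma card_walks_Suc:
  assumes "2 \<le> h"
  shows "card (walks (Suc k) t h) = (\<Sum>x\<in>{2..Suc h} - {h}. card (walks k t x)) +
     (if 0 < t then card (walks k (t - 1) h) else 0)"
proof -
  have "card (\<Union>x\<in>{2..Suc h} - {h}. (#) x ` walks k t x) = (\<Sum>x\<in>{2..Suc h} - {h}. card ((#) x ` walks k t x))"
    by (rule card_UN_disjoint) (auto simp: finite_walks)
  also have "\<dots> = (\<Sum>x\<in>{2..Suc h} - {h}. card (walks k t x))"
    by (simp add: card_image)
  finally show ?thesis unfolding walks_Suc
    using assms by (subst card_Un_disjoint) (auto simp: finite_walks card_image)
qed

text \<open>First steps that change the height contribute \<open>k choose t\<close> times the sum in
  \<open>level_free_Suc\<close>; a level first step contributes \<open>k choose (t - 1)\<close>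
  times the same number. Pascal's rule adds the two.\<close>

lemma card_walks: "card (walks k t (h + 2)) = (k choose t) * level_free (k - t) h"
proof (induction k arbitrary: t h)
  case 0
  then show ?case by (simp add: walks_0 level_free_0)
next
  case (Suc k)
  \<comment> \<open>With heights shifted by 2, the targets are the single larger value
    \<open>Suc h\<close> and all smaller values.\<close>
  have "{2..Suc (h + 2)} - {h + 2} = insert (Suc h + 2) ((\<lambda>j. j + 2) ` {..<h})"
    by (auto simp: image_iff Bex_def) presburger
  then have "(\<Sum>x\<in>{2..Suc (h + 2)} - {h + 2}. card (walks k t x)) =
      (\<Sum>x\<in>insert (Suc h + 2) ((\<lambda>j. j + 2) ` {..<h}). card (walks k t x))"
    by (rule arg_cong)
  also have "\<dots> = card (walks k t (Suc h + 2)) + (\<Sum>j<h. card (walks k t (j + 2)))"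
    by (subst sum.insert) (auto simp: sum.reindex inj_on_def)
  also have "\<dots> = (k choose t) * (level_free (k - t) (Suc h) + (\<Sum>j<h. level_free (k - t) j))"
    by (simp only: Suc add_mult_distrib2 sum_distrib_left)
  \<comment> \<open>For \<open>t > k\<close> truncated subtraction breaks the recursion, but the
    binomial coefficient vanishes.\<close>
  also have "\<dots> = (k choose t) * level_free (Suc k - t) h"
    by (cases "t \<le> k") (simp_all add: level_free_Suc Suc_diff_le binomial_eq_0)
  finally show ?case
    by (cases t) (simp_all add: card_walks_Suc Suc[of _ h, simplified] add_mult_distrib)
qed

lemma card_walks_2: "card (walks k t 2) = (k choose t) * motzkin (k - t)"
  using card_walks[of k t 0] by (simp add: level_free_def motzkin_paths_0 numeral_2_eq_2)

section \<open>Fibonacci polyominoes as translated staircases\<close>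

text \<open>A path from \<open>c\<close> to \<open>d\<close> inside \<open>P\<close> must lose the
  property \<open>Q\<close> between two consecutive cells.\<close>

lemma polyomino_cut:
  assumes "polyomino P" "c \<in> P" "Q c" "d \<in> P" "\<not> Q d"
  obtains a b where "a \<in> P" "b \<in> P" "adjacent a b" "Q a" "\<not> Q b"
proof -
  let ?r = "{(a, b). a \<in> P \<and> b \<in> P \<and> adjacent a b}"
  have "(c, d) \<in> ?r\<^sup>*" using assms by (auto simp: polyomino_def)
  then have "Q d \<or> (\<exists>a b. (a, b) \<in> ?r \<and> Q a \<and> \<not> Q b)"
    by (induction rule: rtrancl_induct) (use \<open>Q c\<close> in blast)+
  then show thesis using that assms by blast
qed

lemma mem_translate:
  fixes c v :: "'a::ab_group_add"
  shows "c \<in> (+) v ` A \<longleftrightarrow> c - v \<in> A"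
  by (auto simp: image_iff intro!: bexI[of _ "c - v"])

lemma adjacent_crossing:
  assumes "adjacent a b" "fst a \<le> x" "x < fst b"
  shows "fst a = x" "fst b = x + 1" "snd a = snd b"
  using assms unfolding adjacent_def by linarith+

(* Columns are listed from right to left; column \<open>- i\<close> has its lowest cell in row \<open>- i\<close>. *)
definition staircase :: "nat list \<Rightarrow> cell set" where
  "staircase hs = {(x, y). \<exists>i<length hs. x = - int i \<and> x \<le> y \<and> y < x + int (hs ! i)}"

text \<open>The value 0 beyond the list lets one formula also cover the empty columns to the left of
  the staircase.\<close>

definition column_height :: "nat list \<Rightarrow> nat \<Rightarrow> nat" where
  "column_height hs i = (if i < length hs then hs ! i else 0)"

lemma mem_staircase: "(- int i, y) \<in> staircase hs \<longleftrightarrow> - int i \<le> y \<and> y < - int i + int (column_height hs i)"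
  by (auto simp: staircase_def column_height_def)

lemma column_staircase: "column (staircase hs) (- int i) = {- int i..<- int i + int (column_height hs i)}"
  by (auto simp: column_def mem_staircase)

lemma column_staircase_pos: "0 < x \<Longrightarrow> column (staircase hs) x = {}"
  by (auto simp: column_def staircase_def)

lemma finite_column: "finite P \<Longrightarrow> finite (column P x)"
  by (rule finite_subset[of _ "snd ` P"]) (force simp: column_def)+

lemma convex_int_set_eq:
  fixes A :: "int set"
  assumes "finite A" "A \<noteq> {}" "\<forall>y\<in>A. \<forall>z\<in>A. {y..z} \<subseteq> A"
  shows "A = {Min A..<Min A + int (card A)}"
proof -
  have "A \<subseteq> {Min A..Max A}" using assms by auto
  moreover have "{Min A..Max A} \<subseteq> A" using assms Min_in[of A] Max_in[of A] by blast
  ultimately have A: "A = {Min A..Max A}" ..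
  then have "card A = nat (Max A - Min A + 1)"
    by (metis card_atLeastAtMost_int add_diff_eq diff_add_eq)
  moreover have "Min A \<le> Max A" using assms by simp
  ultimately have "{Min A..Max A} = {Min A..<Min A + int (card A)}" by auto
  with A show ?thesis by (rule trans)
qed

text \<open>Index 0 is the rightmost column. Every other column starts one row below its right
  neighbour and needs a second cell to touch it.\<close>

definition admissible :: "nat list \<Rightarrow> bool" where
  "admissible hs \<longleftrightarrow> hs \<noteq> [] \<and> 1 \<le> hs ! 0 \<and> (\<forall>i. 0 < i \<and> i < length hs \<longrightarrow> 2 \<le> hs ! i)"

text \<open>Connectedness makes the occupied columns an interval and lets neighbours share a row. As
  the right neighbour starts one row higher, the left one has at least two cells. Lowest cells and
  heights then determine \<open>P\<close>.\<close>

lemma fibonacci_polyomino_staircase: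
  assumes "fibonacci_polyomino P"
  obtains v hs where "admissible hs" "P = (+) v ` staircase hs"
proof -
  have P: "polyomino P" "column_convex P" "finite P" "P \<noteq> {}"
    and steps: "\<And>x. column P x \<noteq> {} \<Longrightarrow> column P (x + 1) \<noteq> {} \<Longrightarrow>
        Min (column P (x + 1)) = Min (column P x) + 1"
    using assms by (auto simp: fibonacci_polyomino_def polyomino_def)
  define r where "r = Max (fst ` P)"
  define l where "l = Min (fst ` P)"
  have bounds: "l \<le> fst c \<and> fst c \<le> r" if "c \<in> P" for c
    using that P by (auto simp: l_def r_def)
  have "l \<in> fst ` P" "r \<in> fst ` P" using P by (simp_all add: l_def r_def)
  then obtain cl cr where cl: "cl \<in> P" "fst cl = l" and cr: "cr \<in> P" "fst cr = r" by auto
  have overlap: "\<exists>y. (x, y) \<in> P \<and> (x + 1, y) \<in> P" if x: "l \<le> x" "x < r" for x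
  proof -
    \<comment> \<open>Cut along the vertical line between columns \<open>x\<close> and
      \<open>x + 1\<close>.\<close>
    obtain a b where "a \<in> P" "b \<in> P" "adjacent a b" "fst a \<le> x" "\<not> fst b \<le> x"
      by (rule polyomino_cut[of P cl "\<lambda>c. fst c \<le> x" cr]) (use P cl cr x in auto)
    then have "a = (x, snd a)" "b = (x + 1, snd a)"
      using adjacent_crossing[of a b x] by (auto simp: prod_eq_iff)
    then show ?thesis using \<open>a \<in> P\<close> \<open>b \<in> P\<close> by metis
  qed
  have nonempty: "column P x \<noteq> {} \<longleftrightarrow> l \<le> x \<and> x \<le> r" for x
  proof
    assume "column P x \<noteq> {}"
    then show "l \<le> x \<and> x \<le> r" using bounds by (fastforce simp: column_def)
  next
    assume "l \<le> x \<and> x \<le> r"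
    then show "column P x \<noteq> {}"
      using overlap[of x] cr by (cases "x = r"; cases cr) (auto simp: column_def)
  qed
  have col: "column P x = {Min (column P x)..<Min (column P x) + int (height P x)}"
    if "l \<le> x" "x \<le> r" for x
    unfolding height_def
    by (rule convex_int_set_eq) (use P nonempty that in \<open>auto simp: finite_column column_convex_def\<close>)
  have tall: "2 \<le> height P x" if x: "l \<le> x" "x < r" for x
  proof -
    obtain y where y: "y \<in> column P x" "y \<in> column P (x + 1)"
      using overlap[OF x] by (auto simp: column_def)
    have "Min (column P x) + 1 \<le> y"
      using y steps[of x] P by (metis Min_le empty_iff finite_column)
    moreover have "y < Min (column P x) + int (height P x)"
      using col[of x] y(1) x by (metis atLeastLessThan_iff less_imp_le)
    ultimately show ?thesis by linarith
  qed
  define b where "b = Min (column P r)"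
  have bottom: "Min (column P (r - int i)) = b - int i" if "int i \<le> r - l" for i
    using that
  proof (induction i)
    case (Suc i)
    then show ?case using steps[of "r - int (Suc i)"] by (simp add: nonempty)
  qed (simp add: b_def)
  define hs where "hs = map (\<lambda>i. height P (r - int i)) [0..<Suc (nat (r - l))]"
  have "l \<le> r" using bounds[OF cl(1)] by simp
  have "height P r \<noteq> 0"
    using nonempty[of r] P \<open>l \<le> r\<close> by (simp add: height_def finite_column)
  then have "admissible hs"
    using tall \<open>l \<le> r\<close> unfolding admissible_def hs_def
    by (auto simp del: upt_Suc simp: nth_append)
  \<comment> \<open>The translation takes the origin to the lowest cell of the rightmost
    column.\<close>
  moreover have "P = (+) (r, b) ` staircase hs"
  proof -
    have "c \<in> P \<longleftrightarrow> c - (r, b) \<in> staircase hs" for c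
    proof (cases "l \<le> fst c \<and> fst c \<le> r")
      case True
      define i where "i = nat (r - fst c)"
      have i: "fst c = r - int i" "int i \<le> r - l" using True by (auto simp: i_def)
      have "c \<in> P \<longleftrightarrow> snd c \<in> column P (fst c)" by (simp add: column_def)
      also have "\<dots> \<longleftrightarrow> b - int i \<le> snd c \<and> snd c < b - int i + int (height P (r - int i))"
        using col[of "fst c"] bottom[of i] True unfolding i(1)
        by (metis atLeastLessThan_iff i(2))
      also have "\<dots> \<longleftrightarrow> (- int i, snd c - b) \<in> staircase hs"
        using i(2) by (auto simp: mem_staircase column_height_def hs_def simp del: upt_Suc)
      finally show ?thesis by (cases c) (use i in simp)
    next
      case False
      then have "c - (r, b) \<notin> staircase hs"
        using \<open>l \<le> r\<close> by (cases c) (auto simp: staircase_def hs_def)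
      then show ?thesis using bounds False by blast
    qed
    then show ?thesis using mem_translate by blast
  qed
  ultimately show thesis using that by blast
qed

lemma finite_staircase: "finite (staircase hs)"
proof -
  have "staircase hs = (\<Union>i<length hs. Pair (- int i) ` {- int i..<- int i + int (hs ! i)})"
    by (auto simp: staircase_def)
  then show ?thesis by simp
qed

lemma admissible_ge_1: "admissible hs \<Longrightarrow> i < length hs \<Longrightarrow> 1 \<le> hs ! i"
  by (cases i) (fastforce simp: admissible_def)+

lemma column_staircase_nonempty:
  assumes "admissible hs"
  shows "column (staircase hs) x \<noteq> {} \<longleftrightarrow> x \<le> 0 \<and> nat (- x) < length hs"
proof (cases "x \<le> 0")
  case True
  then show ?thesis
    using column_staircase[of hs "nat (- x)"] admissible_ge_1[OF assms, of "nat (- x)"]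
    by (auto simp: column_height_def)
qed (simp add: column_staircase_pos)

text \<open>Every cell is joined to the origin: down its column to the lowest cell, then repeatedly
  one cell up and one to the right, which leads to the next lowest cell.\<close>

lemma fibonacci_polyomino_staircaseI:
  assumes "admissible hs"
  shows "fibonacci_polyomino (staircase hs)"
proof -
  let ?P = "staircase hs"
  let ?r = "{(a, b). a \<in> ?P \<and> b \<in> ?P \<and> adjacent a b}"
  have "sym ?r" by (auto simp: sym_def adjacent_def)
  have up: "((- int i, - int i), (- int i, - int i + int j)) \<in> ?r\<^sup>*" if "j < column_height hs i" for i j
    using that
  proof (induction j)
    case (Suc j)
    have "((- int i, - int i + int j), (- int i, - int i + int (Suc j))) \<in> ?r"
      using Suc.prems by (auto simp: mem_staircase adjacent_def)
    then show ?case using Suc by (meson Suc_lessD rtrancl.rtrancl_into_rtrancl)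
  qed simp
  have bottom: "((- int i, - int i), (0, 0)) \<in> ?r\<^sup>*" if "i < length hs" for i
    using that
  proof (induction i)
    case (Suc i)
    have "2 \<le> column_height hs (Suc i)" "1 \<le> column_height hs i"
      using assms Suc.prems admissible_ge_1[OF assms, of i] by (auto simp: column_height_def admissible_def)
    then have "((- int (Suc i), - int (Suc i)), (- int (Suc i), - int i)) \<in> ?r"
      "((- int (Suc i), - int i), (- int i, - int i)) \<in> ?r"
      by (simp_all only: mem_staircase mem_Collect_eq case_prod_conv adjacent_def) auto
    then show ?case using Suc by (meson Suc_lessD converse_rtrancl_into_rtrancl)
  qed simp
  have origin: "(c, (0, 0)) \<in> ?r\<^sup>*" if c: "c \<in> ?P" for c
  proof -
    obtain i y where c: "c = (- int i, y)" "i < length hs" "- int i \<le> y" "y < - int i + int (hs ! i)"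
      using c by (auto simp: staircase_def)
    have "((- int i, - int i), c) \<in> ?r\<^sup>*"
      using up[of "nat (y + int i)" i] c by (auto simp: column_height_def)
    then show ?thesis
      using bottom[OF c(2)] \<open>sym ?r\<close> by (meson rtrancl_trans sym_rtrancl symD)
  qed
  have "(c, d) \<in> ?r\<^sup>*" if "c \<in> ?P" "d \<in> ?P" for c d
    using origin[OF that(1)] origin[OF that(2)] \<open>sym ?r\<close> by (meson rtrancl_trans sym_rtrancl symD)
  moreover have "?P \<noteq> {}"
    using column_staircase_nonempty[OF assms, of 0] assms by (auto simp: column_def admissible_def)
  ultimately have "polyomino ?P" by (auto simp: polyomino_def finite_staircase)
  moreover have "column_convex ?P"
    unfolding column_convex_def by (auto simp: column_def staircase_def)
  moreover have Min_column: "Min (column ?P x) = x" if "column ?P x \<noteq> {}" for x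
  proof -
    define i where "i = nat (- x)"
    have x: "x = - int i"
      using that column_staircase_nonempty[OF assms] by (auto simp: i_def)
    show ?thesis using that unfolding x column_staircase by (auto intro!: Min_eqI)
  qed
  ultimately show ?thesis
    unfolding fibonacci_polyomino_def by (metis add.commute)
qed

section \<open>Semiperimeters of a staircase\<close>

lemma card_boundary_translate:
  assumes "\<And>c v. edges (v + c) = (+) v ` (edges c :: cell set)"
  shows "card {e. \<exists>!c. c \<in> (+) v ` P \<and> e \<in> edges c} = card {e. \<exists>!c. c \<in> P \<and> e \<in> edges c}"
proof -
  have "{e. \<exists>!c. c \<in> (+) v ` P \<and> e \<in> edges c} = (+) v ` {e. \<exists>!c. c \<in> P \<and> e \<in> edges c}"
  proof (rule set_eqI)
    fix e
    have "c \<in> (+) v ` P \<and> e \<in> edges c \<longleftrightarrow> c - v \<in> P \<and> e - v \<in> edges (c - v)" for c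
      using assms[of v "c - v"] by (simp add: mem_translate)
    moreover have "(\<exists>!c. Q (c - v)) \<longleftrightarrow> (\<exists>!c. Q c)" for Q
      by (metis add_diff_cancel diff_add_cancel)
    ultimately show "e \<in> {e. \<exists>!c. c \<in> (+) v ` P \<and> e \<in> edges c} \<longleftrightarrow>
        e \<in> (+) v ` {e. \<exists>!c. c \<in> P \<and> e \<in> edges c}"
      unfolding mem_translate mem_Collect_eq by simp
  qed
  then show ?thesis by (simp add: card_image)
qed

lemma horizontal_semiperimeter_translate:
  "horizontal_semiperimeter ((+) v ` P) = horizontal_semiperimeter P"
  unfolding horizontal_semiperimeter_def
  by (subst card_boundary_translate) (auto simp: horizontal_edges_def add.assoc)

lemma vertical_semiperimeter_translate:
  "vertical_semiperimeter ((+) v ` P) = vertical_semiperimeter P"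
  unfolding vertical_semiperimeter_def
  by (subst card_boundary_translate) (auto simp: vertical_edges_def add.assoc)

text \<open>An edge borders two unit cells, so it is a boundary edge when exactly one of them is
  occupied.\<close>

lemma ex1_mem_pair:
  assumes "a \<noteq> b"
  shows "(\<exists>!c. c \<in> P \<and> (c = a \<or> c = b)) \<longleftrightarrow> (a \<in> P) \<noteq> (b \<in> P)"
  using assms by metis

lemma horizontal_boundary: "(\<exists>!c. c \<in> P \<and> (x, y) \<in> horizontal_edges c) \<longleftrightarrow> ((x, y) \<in> P) \<noteq> ((x, y - 1) \<in> P)"
proof -
  have "(x, y) \<in> horizontal_edges c \<longleftrightarrow> c = (x, y) \<or> c = (x, y - 1)" for c
    by (cases c) (auto simp: horizontal_edges_def)
  then show ?thesis by (simp add: ex1_mem_pair)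
qed

lemma vertical_boundary: "(\<exists>!c. c \<in> P \<and> (x, y) \<in> vertical_edges c) \<longleftrightarrow> ((x, y) \<in> P) \<noteq> ((x - 1, y) \<in> P)"
proof -
  have "(x, y) \<in> vertical_edges c \<longleftrightarrow> c = (x, y) \<or> c = (x - 1, y)" for c
    by (cases c) (auto simp: vertical_edges_def)
  then show ?thesis by (simp add: ex1_mem_pair)
qed

text \<open>Each column contributes its bottom and its top edge, which are distinct because heights
  are positive.\<close>

lemma horizontal_semiperimeter_staircase:
  assumes "admissible hs"
  shows "horizontal_semiperimeter (staircase hs) = length hs"
proof -
  let ?bot = "(\<lambda>i. (- int i, - int i)) ` {..<length hs}"
  let ?top = "(\<lambda>i. (- int i, - int i + int (hs ! i))) ` {..<length hs}"
  have "{e. \<exists>!c. c \<in> staircase hs \<and> e \<in> horizontal_edges c} = ?bot \<union> ?top"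
  proof (rule set_eqI)
    fix e :: cell
    obtain x y where e: "e = (x, y)" by fastforce
    show "e \<in> {e. \<exists>!c. c \<in> staircase hs \<and> e \<in> horizontal_edges c} \<longleftrightarrow> e \<in> ?bot \<union> ?top"
    proof (cases "\<exists>i<length hs. x = - int i")
      case True
      then obtain i where i: "i < length hs" "x = - int i" by blast
      have "(- int i, y) \<in> ?bot \<longleftrightarrow> y = - int i" "(- int i, y) \<in> ?top \<longleftrightarrow> y = - int i + int (hs ! i)"
        using i(1) by auto
      then show ?thesis
        unfolding e i(2) mem_Collect_eq horizontal_boundary mem_staircase Un_iff
        using admissible_ge_1[OF assms i(1)] i(1) by (auto simp: column_height_def)
    next
      case False
      then show ?thesis unfolding e mem_Collect_eq horizontal_boundary
        by (auto simp: staircase_def)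
    qed
  qed
  moreover have "card (?bot \<union> ?top) = length hs + length hs"
  proof (subst card_Un_disjoint)
    show "?bot \<inter> ?top = {}" using admissible_ge_1[OF assms] by fastforce
  qed (auto simp: card_image inj_on_def)
  ultimately show ?thesis by (simp add: horizontal_semiperimeter_def)
qed

text \<open>Rows of the boundary edges on the vertical line \<open>1 - int i\<close>: the right side
  of the polyomino for \<open>i = 0\<close>, its left side for \<open>i = length hs\<close>.\<close>

definition side_edges :: "nat list \<Rightarrow> nat \<Rightarrow> int set" where
  "side_edges hs i = {y. ((1 - int i, y) \<in> staircase hs) \<noteq> ((- int i, y) \<in> staircase hs)}"

lemma side_edges_0: "side_edges hs 0 = {0..<int (column_height hs 0)}"
proof -
  have "(1, y) \<notin> staircase hs" for y by (simp add: staircase_def)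
  moreover have "(0, y) \<in> staircase hs \<longleftrightarrow> 0 \<le> y \<and> y < int (column_height hs 0)" for y
    using mem_staircase[of 0 y hs] by simp
  ultimately show ?thesis by (auto simp: side_edges_def)
qed

lemma side_edges_Suc:
  "side_edges hs (Suc i) = {y. (- int i \<le> y \<and> y < - int i + int (column_height hs i)) \<noteq>
     (- int (Suc i) \<le> y \<and> y < - int (Suc i) + int (column_height hs (Suc i)))}"
proof -
  have "1 - int (Suc i) = - int i" by simp
  then show ?thesis unfolding side_edges_def by (simp only: mem_staircase)
qed

lemma card_side_edges_length:
  assumes "hs \<noteq> []"
  shows "card (side_edges hs (length hs)) = last hs"
proof -
  obtain m where m: "length hs = Suc m" using assms by (cases "length hs") auto
  then have "side_edges hs (length hs) = {- int m..<- int m + int (hs ! m)}"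
    by (auto simp: side_edges_Suc column_height_def)
  then show ?thesis using m assms by (simp add: last_conv_nth)
qed

text \<open>The left column starts one row lower, which gives one edge at the bottom; the others lie
  between the tops \<open>?t\<close> and \<open>?u\<close>.\<close>

lemma card_side_edges_Suc:
  assumes "Suc i < length hs" "1 \<le> hs ! Suc i"
  shows "int (card (side_edges hs (Suc i))) = 1 + \<bar>int (hs ! i) + 1 - int (hs ! Suc i)\<bar>"
proof -
  let ?t = "- int i + int (hs ! i)" and ?u = "- int (Suc i) + int (hs ! Suc i)"
  have "side_edges hs (Suc i) = insert (- int (Suc i)) {min ?t ?u..<max ?t ?u}"
    using assms by (auto simp: side_edges_Suc column_height_def)
  moreover have "- int (Suc i) \<notin> {min ?t ?u..<max ?t ?u}"
    using assms by auto
  ultimately show ?thesis by (auto simp: max_def min_def)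
qed

lemma vertical_boundary_staircase:
  "card {e. \<exists>!c. c \<in> staircase hs \<and> e \<in> vertical_edges c} = (\<Sum>i\<le>length hs. card (side_edges hs i))"
proof -
  have fin: "finite (side_edges hs i)" for i
  proof (cases i)
    case (Suc j)
    show ?thesis unfolding Suc side_edges_Suc
      by (rule finite_subset[of _ "{- int (Suc j)..<int (column_height hs j + column_height hs (Suc j))}"]) auto
  qed (simp add: side_edges_0)
  have "{e. \<exists>!c. c \<in> staircase hs \<and> e \<in> vertical_edges c} =
      (\<Union>i\<le>length hs. Pair (1 - int i) ` side_edges hs i)"
  proof (rule set_eqI)
    fix e :: cell
    obtain x y where e: "e = (x, y)" by fastforce
    have "((x, y) \<in> staircase hs) \<noteq> ((x - 1, y) \<in> staircase hs) \<Longrightarrow>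
      x \<le> 1 \<and> nat (1 - x) \<le> length hs"
      by (auto simp: staircase_def)
    then show "e \<in> {e. \<exists>!c. c \<in> staircase hs \<and> e \<in> vertical_edges c} \<longleftrightarrow>
      e \<in> (\<Union>i\<le>length hs. Pair (1 - int i) ` side_edges hs i)"
      unfolding e mem_Collect_eq vertical_boundary
      by (auto simp: side_edges_def intro!: bexI[of _ "nat (1 - x)"])
  qed
  also have "card \<dots> = (\<Sum>i\<le>length hs. card (Pair (1 - int i) ` side_edges hs i))"
    by (rule card_UN_disjoint) (auto simp: fin)
  also have "\<dots> = (\<Sum>i\<le>length hs. card (side_edges hs i))"
    by (simp add: card_image inj_on_def)
  finally show ?thesis .
qed

lemma vertical_semiperimeter_staircase:
  assumes "admissible hs" "length hs = Suc m"
  shows "2 * vertical_semiperimeter (staircase hs) = real (hs ! 0) + real (hs ! m) +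
     (\<Sum>i<m. 1 + \<bar>real (hs ! i) + 1 - real (hs ! Suc i)\<bar>)"
proof -
  have "real (card (side_edges hs (Suc i))) = 1 + \<bar>real (hs ! i) + 1 - real (hs ! Suc i)\<bar>" if "i < m" for i
    using card_side_edges_Suc[of i hs] admissible_ge_1[OF assms(1), of "Suc i"] assms(2) that
    by linarith
  moreover have "(\<Sum>i\<le>Suc m. card (side_edges hs i)) = hs ! 0 + (\<Sum>i<m. card (side_edges hs (Suc i))) + hs ! m"
    using card_side_edges_length[of hs] assms
    by (subst sum.atMost_Suc, subst sum.atMost_shift)
      (auto simp: side_edges_0 column_height_def admissible_def last_conv_nth)
  ultimately show ?thesis
    by (simp add: vertical_semiperimeter_def vertical_boundary_staircase assms(2))
qed

(* Telescoping the signed increments, the excess of the vertical over the horizontal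
   semiperimeter is \<open>hs ! 0 - 1\<close> plus the sum of \<open>max 0 (hs ! (i + 1) - hs ! i - 1)\<close>. *)
lemma semiperimeters_eq_iff:
  assumes "admissible hs"
  shows "vertical_semiperimeter (staircase hs) = length hs \<longleftrightarrow> hs ! 0 = 1 \<and> successively step hs"
proof -
  obtain m where m: "length hs = Suc m" using assms by (cases "length hs") (auto simp: admissible_def)
  define d where "d i = real (hs ! i) + 1 - real (hs ! Suc i)" for i
  have "(\<Sum>i<m. d i) = real (hs ! 0) - real (hs ! m) + m"
    unfolding d_def by (induction m) auto
  moreover have "1 + \<bar>d i\<bar> = 1 + d i + 2 * max 0 (- d i)" for i by simp
  then have "(\<Sum>i<m. 1 + \<bar>d i\<bar>) = m + (\<Sum>i<m. d i) + 2 * (\<Sum>i<m. max 0 (- d i))"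
    by (simp only: sum.distrib sum_distrib_left) simp
  ultimately have "vertical_semiperimeter (staircase hs) = real (hs ! 0) + m + (\<Sum>i<m. max 0 (- d i))"
    using vertical_semiperimeter_staircase[OF assms m] unfolding d_def[symmetric] by simp
  moreover have "1 \<le> hs ! 0" using assms by (simp add: admissible_def)
  moreover have "0 \<le> (\<Sum>i<m. max 0 (- d i))" by (simp add: sum_nonneg)
  ultimately have "vertical_semiperimeter (staircase hs) = length hs \<longleftrightarrow>
      hs ! 0 = 1 \<and> (\<Sum>i<m. max 0 (- d i)) = 0"
    unfolding m by auto
  also have "(\<Sum>i<m. max 0 (- d i)) = 0 \<longleftrightarrow> (\<forall>i<m. 0 \<le> d i)"
    by (subst sum_nonneg_eq_0_iff) (simp_all add: max.absorb_iff1[symmetric] Ball_def)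
  \<comment> \<open>\<open>0 \<le> d i\<close> is the upper bound in \<open>step\<close>; the lower
    bound comes from \<open>admissible\<close>.\<close>
  also have "\<dots> \<longleftrightarrow> successively step hs"
    using assms by (auto simp: successively_conv_nth m d_def admissible_def)
  finally show ?thesis .
qed

section \<open>Levels and translation classes\<close>

lemma lev_staircase:
  assumes "admissible hs"
  shows "lev (staircase hs) = levels hs"
proof -
  \<comment> \<open>The list runs from right to left, so the left column of the pair with indices
    \<open>i\<close> and \<open>Suc i\<close> is the one of index \<open>Suc i\<close>.\<close>
  let ?f = "\<lambda>i. - int (Suc i)"
  have h: "height (staircase hs) (- int i) = column_height hs i" for i
    by (simp only: height_def column_staircase) simp
  have "{x. column (staircase hs) x \<noteq> {} \<and> column (staircase hs) (x + 1) \<noteq> {} \<and>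
      height (staircase hs) x = height (staircase hs) (x + 1)} =
      ?f ` {i. Suc i < length hs \<and> hs ! i = hs ! Suc i}" (is "?L = ?R")
  proof (intro equalityI subsetI)
    fix x assume x: "x \<in> ?L"
    then have "x \<le> -1" "nat (- x) < length hs"
      using column_staircase_nonempty[OF assms, of x] column_staircase_nonempty[OF assms, of "x + 1"] by auto
    then have i: "x = ?f (nat (- x) - 1)" "Suc (nat (- x) - 1) < length hs" by auto
    have "x + 1 = - int (nat (- x) - 1)" using i(1) by simp
    then have "column_height hs (Suc (nat (- x) - 1)) = column_height hs (nat (- x) - 1)"
      using x i(1) by (metis (mono_tags, lifting) h mem_Collect_eq)
    then show "x \<in> ?R" using i by (force simp: column_height_def)
  next
    fix x assume "x \<in> ?R"
    then obtain i where i: "x = ?f i" "Suc i < length hs" "hs ! i = hs ! Suc i" by blast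
    have x1: "x + 1 = - int i" using i by simp
    show "x \<in> ?L" unfolding mem_Collect_eq x1 column_staircase_nonempty[OF assms] unfolding i(1) h
      using i by (auto simp: column_height_def)
  qed
  then show ?thesis
    by (simp add: lev_def levels_eq_card card_image inj_on_def del: of_nat_Suc)
qed

text \<open>Both staircases have their rightmost column at 0, so the translation is vertical and
  preserves the number of cells in each column.\<close>

lemma translation_class_staircase_inj:
  assumes "admissible hs" "admissible hs'"
    and "translation_class (staircase hs) = translation_class (staircase hs')"
  shows "hs = hs'"
proof -
  have "(+) 0 ` staircase hs \<in> translation_class (staircase hs')"
    using assms(3) unfolding translation_class_def by blast
  then obtain v where v: "staircase hs = (+) v ` staircase hs'"
    by (auto simp: translation_class_def)
  have ne: "x \<le> 0 \<and> nat (- x) < length hs \<longleftrightarrow> x - fst v \<le> 0 \<and> nat (- (x - fst v)) < length hs'" for x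
    using column_translate[of v "staircase hs'" x] column_staircase_nonempty[OF assms(1), of x]
      column_staircase_nonempty[OF assms(2), of "x - fst v"]
    unfolding v[symmetric] by auto
  have pos: "0 < length hs" "0 < length hs'" using assms by (auto simp: admissible_def)
  then have v1: "fst v = 0" using ne[of 0] ne[of "fst v"] by auto
  have len: "length hs = length hs'"
    using ne[of "- int (length hs)"] ne[of "- int (length hs')"] v1 by auto
  have col: "column (staircase hs) (- int i) = (+) (snd v) ` column (staircase hs') (- int i)" for i
    using column_translate[of v "staircase hs'" "- int i"] unfolding v[symmetric] by (simp add: v1)
  show ?thesis
  proof (rule nth_equalityI[OF len])
    fix i assume "i < length hs"
    moreover have "card (column (staircase hs) (- int i)) = card (column (staircase hs') (- int i))"
      unfolding col by (simp add: card_image)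
    ultimately show "hs ! i = hs' ! i"
      using len by (simp add: column_staircase column_height_def)
  qed
qed

section \<open>Enumeration of the translation classes\<close>

definition height_lists :: "nat \<Rightarrow> nat list set" where
  "height_lists n = {hs. length hs = n \<and> admissible hs \<and> hs ! 0 = 1 \<and> successively step hs}"

lemma fibonacci_polyominoes_eq:
  "\<F> n n = (\<lambda>hs. translation_class (staircase hs)) ` height_lists n"
proof (intro equalityI subsetI)
  fix C assume "C \<in> \<F> n n"
  then obtain P where P: "fibonacci_polyomino P" "horizontal_semiperimeter P = n"
    "vertical_semiperimeter P = n" "C = translation_class P"
    by (auto simp: fibonacci_polyominoes_def)
  obtain v hs where hs: "admissible hs" "P = (+) v ` staircase hs"
    using fibonacci_polyomino_staircase[OF P(1)] .
  have len: "length hs = n"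
    using P(2) horizontal_semiperimeter_staircase[OF hs(1)]
    by (simp add: hs(2) horizontal_semiperimeter_translate)
  moreover have "hs ! 0 = 1 \<and> successively step hs"
    using P(3) semiperimeters_eq_iff[OF hs(1)] len
    by (simp add: hs(2) vertical_semiperimeter_translate)
  moreover have "C = translation_class (staircase hs)"
  proof -
    have "(+) w ` P = (+) (w + v) ` staircase hs" for w
      by (simp add: hs(2) image_image add.assoc)
    moreover have "(+) w ` staircase hs = (+) (w - v) ` P" for w
      by (simp add: hs(2) image_image add.assoc[symmetric])
    ultimately show ?thesis unfolding P(4) translation_class_def by blast
  qed
  ultimately show "C \<in> (\<lambda>hs. translation_class (staircase hs)) ` height_lists n"
    using hs(1) by (auto simp: height_lists_def)
next
  fix C assume "C \<in> (\<lambda>hs. translation_class (staircase hs)) ` height_lists n"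
  then show "C \<in> \<F> n n"
    unfolding fibonacci_polyominoes_def height_lists_def
    using fibonacci_polyomino_staircaseI horizontal_semiperimeter_staircase semiperimeters_eq_iff
    by auto
qed

text \<open>After the height 1 the next height is at least 2 and at most 2. This forced step is no
  level, so all levels lie in the remaining walk from 2.\<close>

lemma height_lists_walks: "{hs \<in> height_lists (k + 2). levels hs = t} = (\<lambda>xs. 1 # 2 # xs) ` walks k t 2"
proof (intro equalityI subsetI)
  fix hs assume hs: "hs \<in> {hs \<in> height_lists (k + 2). levels hs = t}"
  then obtain x y xs where "hs = x # y # xs"
    by (cases hs rule: remdups_adj.cases) (auto simp: height_lists_def)
  moreover from this have "x = 1" "y = 2" using hs by (auto simp: height_lists_def)
  ultimately show "hs \<in> (\<lambda>xs. 1 # 2 # xs) ` walks k t 2"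
    using hs by (auto simp: height_lists_def walks_def)
next
  fix hs assume "hs \<in> (\<lambda>xs. 1 # 2 # xs) ` walks k t 2"
  then obtain xs where hs: "hs = 1 # 2 # xs" "xs \<in> walks k t 2" by blast
  then have succ: "successively step hs" by (simp add: walks_def)
  have "2 \<le> hs ! i" if "0 < i" "i < length hs" for i
    using successively_nth[OF succ, of "i - 1"] that by simp
  then have "admissible hs" using hs by (auto simp: admissible_def)
  then show "hs \<in> {hs \<in> height_lists (k + 2). levels hs = t}"
    using succ hs by (auto simp: height_lists_def walks_def)
qed

theorem corollary4p8:
  fixes n :: nat
  assumes "n \<ge> 2"
  shows "finite (\<F> n n)
    \<and> (\<forall>t\<le>n - 2. card {C \<in> \<F> n n. class_lev C = t} = ((n - 2) choose t) * motzkin (n - 2 - t))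
    \<and> (\<forall>t>n - 2. card {C \<in> \<F> n n. class_lev C = t} = 0)
    \<and> card {C \<in> \<F> n n. class_lev C = 0} = motzkin (n - 2)"
proof -
  let ?c = "\<lambda>hs. translation_class (staircase hs)"
  obtain k where k: "n = k + 2" using assms by (metis le_add_diff_inverse2)
  \<comment> \<open>Finiteness is shown separately because \<open>card\<close> is also 0 on infinite
    sets. Heights start at 1 and grow by at most one per column, hence stay within
    \<open>n\<close>.\<close>
  have "height_lists n \<subseteq> {hs. set hs \<subseteq> {..n} \<and> length hs = n}"
  proof
    fix hs assume hs: "hs \<in> height_lists n"
    have "hs ! i \<le> Suc i" if "i < n" for i
      using that
    proof (induction i)
      case (Suc i)
      then show ?case using hs successively_nth[of step hs i] by (force simp: height_lists_def)
    qed (use hs in \<open>simp add: height_lists_def\<close>)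
    then show "hs \<in> {hs. set hs \<subseteq> {..n} \<and> length hs = n}"
      using hs by (fastforce simp: height_lists_def in_set_conv_nth)
  qed
  then have "finite (\<F> n n)"
    unfolding fibonacci_polyominoes_eq by (simp add: finite_lists_length_eq finite_subset)
  moreover have card: "card {C \<in> \<F> n n. class_lev C = t} = (k choose t) * motzkin (k - t)" for t
  proof -
    have "{C \<in> \<F> n n. class_lev C = t} = ?c ` {hs \<in> height_lists n. levels hs = t}"
      unfolding fibonacci_polyominoes_eq
      by (auto simp: class_lev_translation_class lev_staircase height_lists_def)
    moreover have "inj_on ?c {hs \<in> height_lists n. levels hs = t}"
      by (auto simp: inj_on_def height_lists_def intro: translation_class_staircase_inj)
    ultimately show ?thesis
      unfolding k by (simp add: card_image height_lists_walks card_walks_2 inj_on_def del: add_2_eq_Suc')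
  qed
  ultimately show ?thesis unfolding card by (simp add: k)
qed

end
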